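(* Let $k\ge 0$ and $i\in\{0,1,2\}$ be integers with $3k+i\ge 1$. Then $I(C_{1,3k+i})$ has the same simple homotopy type as $$\begin{cases} \Diamond^{k-1}\vee\Diamond^{k-1} & (i=0),\\ \Diamond^{k-1} & (i=1),\\ \Diamond^{k} & (i=2).\end{cases}$$
   Context: Graphs are finite and undirected; loops and multiple edges are allowed. The planar square grid graph $P_{m,n}$ has vertex set $\{1,\dots,m\}\times\{1,\dots,n\}$, with $(i_1,j_1)$ and $(i_2,j_2)$ adjacent if and only if they differ by exactly $1$ in one coordinate and agree in the other. For $m,n\ge1$, $C_{m,n}$ is the graph obtained from $P_{m,n+1}$ by identifying the vertices $(i,1)$ and $(i,n+1)$ for $i=1,\dots,m$ and the corresponding edges (edge $(i,1)(i+1,1)$ with edge $(i,n+1)(i+1,n+1)$). Thus $C_{1,n}$ is the cycle with $n$ vertices ($C_{1,1}$ is one vertex with a loop, $C_{1,2}$ is two vertices joined by a double edge). An independent set of a graph is a set of vertices no two of which are joined by an edge (a vertex carrying a loop belongs to no independent set). The independence complex $I(G)$ is the simplicial complex whose simplices are the independent sets of $G$ (including the empty set $\emptyset$). $\Diamond^n$ is the join of $n+1$ copies of $\partial\Delta^1$ (two points), a triangulation of the $n$-sphere; $\Diamond^{-1}=\{\emptyset\}$. $K\vee L$ is the wedge sum obtained from the disjoint union by identifying one vertex of each complex. An elementary collapse of a simplicial complex removes a pair of simplices $\sigma\subsetneq\tau$, with $\sigma$ nonempty, $\dim\tau=\dim\sigma+1$, and $\tau$ the only simplex properly containing $\sigma$;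 an elementary expansion is the inverse operation. Two finite simplicial complexes have the same simple homotopy type if they are connected, up to simplicial isomorphism, by a finite sequence of elementary collapses and elementary expansions. *)

theory Defs
  imports Main
begin

section \<open>Multigraphs and their independence complexes\<close>

text \<open>An edge has a set of one (for a loop) or two end vertices; parallel edges are
  different edges with the same ends.\<close>

record ('v, 'e) mgraph =
  verts :: "'v set"
  edges :: "'e set"
  ends :: "'e \<Rightarrow> 'v set"

definition grid_adj :: "nat \<times> nat \<Rightarrow> nat \<times> nat \<Rightarrow> bool" where
  "grid_adj p q \<longleftrightarrow>
     (\<bar>int (fst p) - int (fst q)\<bar> = 1 \<and> snd p = snd q) \<or>
     (fst p = fst q \<and> \<bar>int (snd p) - int (snd q)\<bar> = 1)"

definition planar_grid :: "nat \<Rightarrow> nat \<Rightarrow> (nat \<times> nat, (nat \<times> nat) set) mgraph" where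
  "planar_grid m n =
     \<lparr> verts = {1..m} \<times> {1..n},
       edges = {{p, q} | p q. p \<in> {1..m} \<times> {1..n} \<and> q \<in> {1..m} \<times> {1..n} \<and> grid_adj p q},
       ends = (\<lambda>e. e) \<rparr>"

text \<open>The cylindrical grid is the quotient of \<open>planar_grid m (n + 1)\<close> in which column
  \<open>n + 1\<close> is identified with column \<open>1\<close>.  A class of identified vertices or
  edges is represented by its member that is not contained in column \<open>n + 1\<close>.  The edges are
  thus still edges of the planar grid, and only their ends are wrapped around: no edges
  other than those inside the two columns get merged, so a double edge appears for
  \<open>n = 2\<close> and loops appear for \<open>n = 1\<close>.\<close>

definition wrap_vertex :: "nat \<Rightarrow> nat \<times> nat \<Rightarrow> nat \<times> nat" where
  "wrap_vertex n p = (if snd p = n + 1 then (fst p, 1) else p)"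

definition wrap_edge :: "nat \<Rightarrow> (nat \<times> nat) set \<Rightarrow> (nat \<times> nat) set" where
  "wrap_edge n e = (if \<forall>p\<in>e. snd p = n + 1 then wrap_vertex n ` e else e)"

definition cyl_grid :: "nat \<Rightarrow> nat \<Rightarrow> (nat \<times> nat, (nat \<times> nat) set) mgraph" where
  "cyl_grid m n =
     \<lparr> verts = wrap_vertex n ` verts (planar_grid m (n + 1)),
       edges = wrap_edge n ` edges (planar_grid m (n + 1)),
       ends = (\<lambda>e. wrap_vertex n ` e) \<rparr>"

text \<open>The case \<open>v = w\<close> is included on purpose: it excludes vertices carrying a loop.\<close>

definition independent_set :: "('v, 'e) mgraph \<Rightarrow> 'v set \<Rightarrow> bool" where
  "independent_set G S \<longleftrightarrow>
     S \<subseteq> verts G \<and> (\<forall>v\<in>S. \<forall>w\<in>S. \<not> (\<exists>e\<in>edges G. ends G e = {v, w}))"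

definition independence_complex :: "('v, 'e) mgraph \<Rightarrow> 'v set set" where
  "independence_complex G = {S. independent_set G S}"


section \<open>Finite simplicial complexes\<close>

text \<open>Abstract complexes, given by their sets of simplices, always including the empty one.\<close>

definition finite_complex :: "'a set set \<Rightarrow> bool" where
  "finite_complex K \<longleftrightarrow>
     finite K \<and> (\<forall>\<sigma>\<in>K. finite \<sigma>) \<and> {} \<in> K \<and> (\<forall>\<sigma>\<in>K. \<forall>\<rho>. \<rho> \<subseteq> \<sigma> \<longrightarrow> \<rho> \<in> K)"

definition vertices :: "'a set set \<Rightarrow> 'a set" where
  "vertices K = \<Union>K"

definition simplicial_iso :: "'a set set \<Rightarrow> 'b set set \<Rightarrow> bool" where
  "simplicial_iso K L \<longleftrightarrow>
     (\<exists>f. bij_betw f (vertices K) (vertices L) \<and> L = (\<lambda>\<sigma>. f ` \<sigma>) ` K)"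

text \<open>The union of simplices \<open>s i\<close>, made disjoint by tagging vertices with the index.
  The join over the empty index set is \<open>{{}}\<close>.\<close>

definition join_family :: "'i set \<Rightarrow> ('i \<Rightarrow> 'a set set) \<Rightarrow> ('i \<times> 'a) set set" where
  "join_family I K = {Sigma I s | s. \<forall>i\<in>I. s i \<in> K i}"

definition simplex_boundary :: "nat \<Rightarrow> nat set set" where
  "simplex_boundary d = {\<sigma>. \<sigma> \<subset> {0..d}}"

text \<open>The index is an integer so that the \<open>(-1)\<close>-sphere \<open>{{}}\<close> is covered;
  \<open>{0..n}\<close> has \<open>n + 1\<close> elements for \<open>n \<ge> -1\<close>.\<close>

definition diamond :: "int \<Rightarrow> (int \<times> nat) set set" where
  "diamond n = join_family {0..n} (\<lambda>_. simplex_boundary 1)"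

text \<open>The wedge below may be formed at any pair of vertices; for \<open>n \<ge> 0\<close> there are some:\<close>

lemma vertices_diamond: "vertices (diamond n) = {0..n} \<times> {0, 1}"
proof -
  have "{0..1} = {0, 1::nat}" by auto
  then have "simplex_boundary 1 = Pow {0, 1} - {{0, 1}}"
    unfolding simplex_boundary_def by blast
  also have "\<dots> = {{}, {0}, {1}}"
    by (auto simp: Pow_insert)
  finally have bd: "simplex_boundary (Suc 0) = {{}, {0}, {1}}"
    by simp
  have "(a, b) \<in> vertices (diamond n)" if "a \<in> {0..n}" "b \<in> {0, 1}" for a b
    unfolding vertices_def diamond_def join_family_def using that
    by (auto simp: bd intro!: exI[of _ "Sigma {0..n} (\<lambda>_. {b})"] exI[of _ "\<lambda>_. {b}"])
  moreover have "x \<in> {0..n} \<times> {0, 1}" if "x \<in> vertices (diamond n)" for x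
    using that unfolding vertices_def diamond_def join_family_def by (force simp: bd)
  ultimately show ?thesis by blast
qed

text \<open>The vertex \<open>w\<close> of \<open>L\<close> is identified with the vertex \<open>v\<close> of
  \<open>K\<close>, and represented by \<open>Inl v\<close>.\<close>

definition wedge :: "'a set set \<Rightarrow> 'a \<Rightarrow> 'b set set \<Rightarrow> 'b \<Rightarrow> ('a + 'b) set set" where
  "wedge K v L w =
     (\<lambda>\<sigma>. Inl ` \<sigma>) ` K \<union>
     (\<lambda>\<tau>. (\<lambda>x. if x = w then Inl v else Inr x) ` \<tau>) ` L"


section \<open>Simple homotopy type\<close>

definition elementary_collapse :: "'a set set \<Rightarrow> 'a set set \<Rightarrow> bool" where
  "elementary_collapse K L \<longleftrightarrow> finite_complex K \<and>
     (\<exists>\<sigma>\<in>K. \<exists>\<tau>\<in>K. \<sigma> \<noteq> {} \<and> \<sigma> \<subset> \<tau> \<and> card \<tau> = card \<sigma> + 1 \<and>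
        (\<forall>\<rho>\<in>K. \<sigma> \<subset> \<rho> \<longrightarrow> \<rho> = \<tau>) \<and> L = K - {\<sigma>, \<tau>})"

text \<open>Expansions may need new vertices, so the sequence of moves takes place among
  complexes with vertices in the infinite type \<open>nat\<close>, which contain a copy of every finite
  complex.  The expansions come from the symmetry of \<open>equivclp\<close>.\<close>

definition same_simple_homotopy_type :: "'a set set \<Rightarrow> 'b set set \<Rightarrow> bool" where
  "same_simple_homotopy_type K L \<longleftrightarrow> finite_complex K \<and> finite_complex L \<and>
     (\<exists>K' L' :: nat set set. simplicial_iso K K' \<and> simplicial_iso L L' \<and>
        equivclp (\<lambda>A B. simplicial_iso A B \<or> elementary_collapse A B) K' L')"

end

theory Submission
  imports Defs
begin

text \<open>Forbidding a nonempty simplex \<open>s\<close> whose link is a cone is a sequence of elementary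
  collapses, and every step below is such a move or the inverse of one.  If a cycle contains a
  path \<open>a x y z b\<close>, one may forbid \<open>{a, b}\<close> (the link has apex \<open>y\<close>), then allow
  \<open>{a, x}\<close> again (apex \<open>z\<close>), then delete \<open>z\<close> (apex \<open>x\<close>); this turns the cycle with
  \<open>n + 3\<close> vertices into the cycle with \<open>n\<close> vertices and a disjoint edge.  Iteration leaves
  disjoint edges only, whose independence complex is a cross-polytope boundary, together with a
  cycle on at most three vertices.  A triangle contributes a join with three points, which is
  compared with a wedge of two suspensions by means of a prism.\<close>

section \<open>Complexes given by forbidden subsets\<close>

text \<open>With non-faces as data, every move of the proof is a change of \<open>F\<close>. Members
  of \<open>F\<close> need not be edges: a singleton deletes a vertex, which covers both loops and
  vertex deletions.\<close>

definition avoiding :: "'a set \<Rightarrow> 'a set set \<Rightarrow> 'a set set" where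
  "avoiding V F = {\<sigma>. \<sigma> \<subseteq> V \<and> (\<forall>e\<in>F. \<not> e \<subseteq> \<sigma>)}"

lemma finite_complex_avoiding:
  assumes "finite V" "{} \<notin> F"
  shows "finite_complex (avoiding V F)"
proof -
  have "avoiding V F \<subseteq> Pow V" by (auto simp: avoiding_def)
  then have "finite (avoiding V F)" using assms(1) finite_subset by blast
  then show ?thesis
    using assms unfolding finite_complex_def avoiding_def
    by (auto dest: finite_subset)
qed

lemma avoiding_image:
  assumes "inj_on f V" "\<Union>F \<subseteq> V"
  shows "(`) f ` avoiding V F = avoiding (f ` V) ((`) f ` F)"
proof -
  have eq: "f ` e \<subseteq> f ` \<sigma> \<longleftrightarrow> e \<subseteq> \<sigma>" if "\<sigma> \<subseteq> V" "e \<in> F" for e \<sigma>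
  proof -
    have "e \<subseteq> V" using that assms(2) by blast
    then show ?thesis using that assms(1) unfolding inj_on_def by blast
  qed
  show ?thesis
  proof (intro set_eqI iffI)
    fix \<rho> assume "\<rho> \<in> (`) f ` avoiding V F"
    then show "\<rho> \<in> avoiding (f ` V) ((`) f ` F)"
      using eq by (auto simp: avoiding_def)
  next
    fix \<rho> assume r: "\<rho> \<in> avoiding (f ` V) ((`) f ` F)"
    then obtain \<sigma> where "\<sigma> \<subseteq> V" "\<rho> = f ` \<sigma>"
      unfolding avoiding_def by (auto elim: subset_imageE)
    then show "\<rho> \<in> (`) f ` avoiding V F"
      using r eq by (auto simp: avoiding_def)
  qed
qed

lemma vertices_avoiding: "vertices (avoiding V F) \<subseteq> V"
  by (auto simp: vertices_def avoiding_def)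

section \<open>Images of complexes and of wedges\<close>

lemma simplicial_iso_image:
  assumes "inj_on f (vertices K)"
  shows "simplicial_iso K ((`) f ` K)"
proof -
  have "vertices ((`) f ` K) = f ` vertices K"
    by (auto simp: vertices_def)
  then show ?thesis
    using assms unfolding simplicial_iso_def bij_betw_def by blast
qed

text \<open>The maps glue to \<open>case_sum f h\<close>, injective because the two images meet at
  most in the common value at the base points. This turns a tagged wedge into a plain union inside
  one vertex type.\<close>

lemma simplicial_iso_wedge:
  assumes "inj_on f (vertices K)" "inj_on h (vertices L)" "v \<in> vertices K" "f v = h w"
    and "\<And>x y. x \<in> vertices K \<Longrightarrow> y \<in> vertices L \<Longrightarrow> y \<noteq> w \<Longrightarrow> f x \<noteq> h y"
  shows "simplicial_iso (wedge K v L w) ((`) f ` K \<union> (`) h ` L)"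
proof -
  let ?j = "\<lambda>x. if x = w then Inl v else Inr x"
  let ?c = "case_sum f h"
  have l: "?c ` Inl ` \<sigma> = f ` \<sigma>" for \<sigma> by (simp add: image_image)
  have "?c (?j x) = h x" for x using assms(4) by simp
  then have r: "?c ` ?j ` \<sigma> = h ` \<sigma>" for \<sigma> unfolding image_image by simp
  have "(`) ?c ` wedge K v L w = (\<lambda>\<sigma>. ?c ` Inl ` \<sigma>) ` K \<union> (\<lambda>\<sigma>. ?c ` ?j ` \<sigma>) ` L"
    by (simp only: wedge_def image_Un image_image)
  then have img: "(`) ?c ` wedge K v L w = (`) f ` K \<union> (`) h ` L" unfolding l r .
  have "vertices (wedge K v L w) = Inl ` vertices K \<union> ?j ` vertices L"
    by (simp only: vertices_def wedge_def Union_Un_distrib image_Union)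
  also have "\<dots> \<subseteq> Inl ` vertices K \<union> Inr ` (vertices L - {w})" using assms(3) by auto
  finally have sub: "vertices (wedge K v L w) \<subseteq> Inl ` vertices K \<union> Inr ` (vertices L - {w})" .
  have "inj_on ?c (Inl ` vertices K \<union> Inr ` (vertices L - {w}))"
  proof (rule inj_onI)
    fix a b assume "a \<in> Inl ` vertices K \<union> Inr ` (vertices L - {w})"
      "b \<in> Inl ` vertices K \<union> Inr ` (vertices L - {w})" "?c a = ?c b"
    then show "a = b"
      using assms(1,2) assms(5) by (cases a; cases b) (auto dest: inj_onD, metis+)
  qed
  from simplicial_iso_image[OF inj_on_subset[OF this sub]] show ?thesis unfolding img .
qed

lemma finite_complex_image:
  assumes "finite_complex K"
  shows "finite_complex ((`) f ` K)"
proof -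
  have "\<rho> \<in> (`) f ` K" if "\<sigma> \<in> K" "\<rho> \<subseteq> f ` \<sigma>" for \<sigma> \<rho>
    using that assms unfolding finite_complex_def by (metis image_eqI subset_image_iff)
  then show ?thesis using assms unfolding finite_complex_def by auto
qed

lemma finite_complex_Un:
  assumes "finite_complex K" "finite_complex L"
  shows "finite_complex (K \<union> L)"
  using assms unfolding finite_complex_def by (simp add: ball_Un)

lemma finite_complex_wedge:
  assumes "finite_complex K" "finite_complex L"
  shows "finite_complex (wedge K v L w)"
  unfolding wedge_def by (intro finite_complex_Un finite_complex_image assms)

section \<open>Removing stars with conical links\<close>

text \<open>Adding or removing \<open>x\<close> pairs up all simplices containing \<open>s\<close>;
  the pairs are collapsed from the top down, by induction on the number of simplices.\<close>

lemma collapse_cone_star: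
  assumes "finite_complex K" "s \<noteq> {}" "x \<notin> s"
    and "\<And>\<sigma>. \<sigma> \<in> K \<Longrightarrow> s \<subseteq> \<sigma> \<Longrightarrow> insert x \<sigma> \<in> K"
  shows "elementary_collapse\<^sup>*\<^sup>* K {\<sigma> \<in> K. \<not> s \<subseteq> \<sigma>}"
  using assms
proof (induction "card K" arbitrary: K rule: less_induct)
  case less
  have fin: "finite K" and sub: "\<And>\<sigma> \<rho>. \<sigma> \<in> K \<Longrightarrow> \<rho> \<subseteq> \<sigma> \<Longrightarrow> \<rho> \<in> K"
    and fs: "\<And>\<sigma>. \<sigma> \<in> K \<Longrightarrow> finite \<sigma>"
    using less.prems(1) by (auto simp: finite_complex_def)
  note cone = less.prems(4)
  show ?case
  proof (cases "\<exists>\<sigma>\<in>K. s \<subseteq> \<sigma>")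
    case False
    then have "{\<sigma> \<in> K. \<not> s \<subseteq> \<sigma>} = K" by blast
    then show ?thesis by simp
  next
    case True
    then obtain \<sigma>0 where "\<sigma>0 \<in> K" "s \<subseteq> \<sigma>0" by blast
    \<comment> \<open>A maximal member of \<open>X\<close> is a free face: its only proper coface
      arises by adding \<open>x\<close>.\<close>
    define X where "X = {\<sigma> \<in> K. s \<subseteq> \<sigma> \<and> x \<notin> \<sigma>}"
    have "\<sigma>0 - {x} \<in> X"
      using \<open>\<sigma>0 \<in> K\<close> \<open>s \<subseteq> \<sigma>0\<close> less.prems(3) by (auto simp: X_def intro: sub)
    moreover have "finite X" using fin by (simp add: X_def)
    ultimately obtain \<sigma> where "\<sigma> \<in> X" and max: "\<And>\<rho>. \<rho> \<in> X \<Longrightarrow> \<sigma> \<subseteq> \<rho> \<Longrightarrow> \<sigma> = \<rho>"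
      using finite_has_maximal[of X] by auto
    then have "\<sigma> \<in> K" "s \<subseteq> \<sigma>" "x \<notin> \<sigma>" by (auto simp: X_def)
    define \<tau> where "\<tau> = insert x \<sigma>"
    have "\<tau> \<in> K" using cone \<open>\<sigma> \<in> K\<close> \<open>s \<subseteq> \<sigma>\<close> by (simp add: \<tau>_def)
    have above: "\<rho> = \<sigma> \<or> \<rho> = \<tau>" if "\<rho> \<in> K" "\<sigma> \<subseteq> \<rho>" for \<rho>
    proof -
      \<comment> \<open>The set \<open>\<rho> - {x}\<close> still contains \<open>\<sigma>\<close>,
        hence \<open>s\<close>, so it lies in \<open>X\<close> and maximality applies.\<close>
      have "\<sigma> = \<rho> - {x}"
        using that \<open>x \<notin> \<sigma>\<close> \<open>s \<subseteq> \<sigma>\<close> by (intro max) (auto simp: X_def intro: sub)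
      then show ?thesis unfolding \<tau>_def by blast
    qed
    let ?L = "K - {\<sigma>, \<tau>}"
    have "\<sigma> \<subset> \<tau>" using \<open>x \<notin> \<sigma>\<close> by (auto simp: \<tau>_def)
    have "card \<tau> = card \<sigma> + 1" using \<open>x \<notin> \<sigma>\<close> fs[OF \<open>\<sigma> \<in> K\<close>] by (simp add: \<tau>_def)
    have up: "\<forall>\<rho>\<in>K. \<sigma> \<subset> \<rho> \<longrightarrow> \<rho> = \<tau>" using above by blast
    have "\<sigma> \<noteq> {}" using less.prems(2) \<open>s \<subseteq> \<sigma>\<close> by auto
    then have step: "elementary_collapse K ?L"
      unfolding elementary_collapse_def
      apply (intro conjI less.prems(1))
      apply (rule bexI[OF _ \<open>\<sigma> \<in> K\<close>], rule bexI[OF _ \<open>\<tau> \<in> K\<close>])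
      using up \<open>\<sigma> \<subset> \<tau>\<close> \<open>card \<tau> = card \<sigma> + 1\<close> by (intro conjI refl)
    have not_above: "\<not> \<sigma> \<subseteq> \<mu>" if "\<mu> \<in> ?L" for \<mu>
      using that above by blast
    have down: "\<rho> \<in> ?L" if "\<mu> \<in> ?L" "\<rho> \<subseteq> \<mu>" for \<rho> \<mu>
    proof -
      have "\<rho> \<noteq> \<sigma>" "\<rho> \<noteq> \<tau>" using not_above[OF that(1)] that(2) \<open>\<sigma> \<subset> \<tau>\<close> by auto
      moreover have "\<rho> \<in> K" using that sub by auto
      ultimately show ?thesis by blast
    qed
    have "{} \<in> ?L"
      using less.prems(1,2) \<open>s \<subseteq> \<sigma>\<close> \<open>\<sigma> \<subset> \<tau>\<close> by (auto simp: finite_complex_def)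
    then have L: "finite_complex ?L"
      unfolding finite_complex_def using fin fs down by blast
    \<comment> \<open>The cone property survives the collapse: a simplex whose extension by
      \<open>x\<close> is \<open>\<tau>\<close> contains \<open>\<sigma>\<close>, hence has itself
      been removed.\<close>
    have "insert x \<mu> \<in> ?L" if "\<mu> \<in> ?L" "s \<subseteq> \<mu>" for \<mu>
    proof -
      have "insert x \<mu> \<noteq> \<sigma>" using \<open>x \<notin> \<sigma>\<close> by blast
      moreover have "insert x \<mu> \<noteq> \<tau>"
      proof
        assume "insert x \<mu> = \<tau>"
        then have "\<sigma> \<subseteq> insert x \<mu>" by (auto simp: \<tau>_def)
        then show False using not_above[OF that(1)] \<open>x \<notin> \<sigma>\<close> by blast
      qed
      ultimately show ?thesis using cone that by blast
    qed
    moreover have "card ?L < card K"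
      using fin \<open>\<sigma> \<in> K\<close> by (intro psubset_card_mono) auto
    ultimately have "elementary_collapse\<^sup>*\<^sup>* ?L {\<sigma> \<in> ?L. \<not> s \<subseteq> \<sigma>}"
      using less.hyps L less.prems(2,3) by blast
    moreover have "{\<sigma> \<in> ?L. \<not> s \<subseteq> \<sigma>} = {\<sigma> \<in> K. \<not> s \<subseteq> \<sigma>}"
      using \<open>s \<subseteq> \<sigma>\<close> \<open>\<sigma> \<subset> \<tau>\<close> by blast
    ultimately show ?thesis
      using step by (simp add: converse_rtranclp_into_rtranclp)
  qed
qed

text \<open>Each \<open>s\<close> may have its own apex. Since the apex lies outside all members of
  \<open>D\<close>, forbidding other members of \<open>D\<close> does not destroy the cones, so they
  are checked in the initial complex only.\<close>

lemma collapse_forbid: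
  assumes "finite D" "finite V" "{} \<notin> F" "{} \<notin> D"
    and "\<And>s. s \<in> D \<Longrightarrow> \<exists>x. x \<notin> \<Union>D \<and>
           (\<forall>\<sigma>\<in>avoiding V F. s \<subseteq> \<sigma> \<longrightarrow> insert x \<sigma> \<in> avoiding V F)"
  shows "elementary_collapse\<^sup>*\<^sup>* (avoiding V F) (avoiding V (F \<union> D))"
proof -
  have "elementary_collapse\<^sup>*\<^sup>* (avoiding V F) (avoiding V (F \<union> D'))" if "D' \<subseteq> D" for D'
    using finite_subset[OF that assms(1)] that
  proof (induction D' rule: finite_induct)
    case (insert s D')
    have "s \<in> D" using insert.prems by simp
    then obtain x where x: "x \<notin> \<Union>D"
      "\<And>\<sigma>. \<sigma> \<in> avoiding V F \<Longrightarrow> s \<subseteq> \<sigma> \<Longrightarrow> insert x \<sigma> \<in> avoiding V F"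
      using assms(5)[of s] by auto
    have "insert x \<sigma> \<in> avoiding V (F \<union> D')" if "\<sigma> \<in> avoiding V (F \<union> D')" "s \<subseteq> \<sigma>" for \<sigma>
    proof -
      have "\<sigma> \<in> avoiding V F" using that(1) by (auto simp: avoiding_def)
      then have "insert x \<sigma> \<in> avoiding V F" using that(2) by (rule x(2))
      moreover have "\<not> d \<subseteq> insert x \<sigma>" if "d \<in> D'" for d
      proof -
        have "x \<notin> d" "\<not> d \<subseteq> \<sigma>"
          using that x(1) insert.prems \<open>\<sigma> \<in> avoiding V (F \<union> D')\<close> by (auto simp: avoiding_def)
        then show ?thesis by blast
      qed
      ultimately show ?thesis by (auto simp: avoiding_def)
    qed
    moreover have "finite_complex (avoiding V (F \<union> D'))"
      using assms(2-4) insert.prems by (intro finite_complex_avoiding) auto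
    moreover have "s \<noteq> {}" "x \<notin> s" using x(1) insert.prems assms(4) by auto
    ultimately have "elementary_collapse\<^sup>*\<^sup>* (avoiding V (F \<union> D'))
        {\<sigma> \<in> avoiding V (F \<union> D'). \<not> s \<subseteq> \<sigma>}"
      by (intro collapse_cone_star)
    also have "{\<sigma> \<in> avoiding V (F \<union> D'). \<not> s \<subseteq> \<sigma>} = avoiding V (F \<union> insert s D')"
      by (auto simp: avoiding_def)
    finally show ?case using insert.IH insert.prems by (meson insert_subset rtranclp_trans)
  qed simp
  then show ?thesis by blast
qed

lemma collapse_forbid_one:
  assumes "finite V" "{} \<notin> F" "s \<noteq> {}" "x \<notin> s"
    and "\<And>\<sigma>. \<sigma> \<in> avoiding V F \<Longrightarrow> s \<subseteq> \<sigma> \<Longrightarrow> insert x \<sigma> \<in> avoiding V F"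
  shows "elementary_collapse\<^sup>*\<^sup>* (avoiding V F) (avoiding V (insert s F))"
  using collapse_forbid[of "{s}" V F] assms by auto

section \<open>Shortening a cycle by three\<close>

abbreviation collapse_equiv :: "'a set set \<Rightarrow> 'a set set \<Rightarrow> bool" where
  "collapse_equiv \<equiv> equivclp elementary_collapse"

lemma collapse_equivI: "elementary_collapse\<^sup>*\<^sup>* K L \<Longrightarrow> collapse_equiv K L"
  by (induction rule: rtranclp_induct) (auto intro: equivclp_into_equivclp)

text \<open>The case \<open>a = b\<close> is allowed; it turns a 4-cycle into an edge and a looped vertex.\<close>

lemma collapse_equiv_path:
  assumes "finite V" "{} \<notin> B" "x \<notin> \<Union>B" "y \<notin> \<Union>B" "z \<notin> \<Union>B"
    and V: "x \<in> V" "y \<in> V" "z \<in> V"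
    and "distinct [x, y, z]" "a \<notin> {x, y, z}" "b \<notin> {x, y, z}"
  shows "collapse_equiv (avoiding V (B \<union> {{a, x}, {x, y}, {y, z}, {z, b}}))
           (avoiding (V - {z}) (B \<union> {{a, b}, {x, y}}))"
proof -
  let ?F2 = "B \<union> {{x, y}, {y, z}, {z, b}, {a, b}}"
  have xyz: "\<not> e \<subseteq> insert u \<sigma>" if "e \<in> B" "\<not> e \<subseteq> \<sigma>" "u \<in> {x, y, z}" for e u \<sigma>
  proof -
    have "u \<notin> e" using that assms(3-5) by auto
    then show ?thesis using that by blast
  qed
  \<comment> \<open>In a simplex containing \<open>{a, b}\<close>, the vertex \<open>a\<close>
    excludes \<open>x\<close> and \<open>b\<close> excludes \<open>z\<close>, the two neighbours of
    \<open>y\<close>.\<close>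
  have "elementary_collapse\<^sup>*\<^sup>* (avoiding V (B \<union> {{a, x}, {x, y}, {y, z}, {z, b}}))
      (avoiding V (insert {a, b} (B \<union> {{a, x}, {x, y}, {y, z}, {z, b}})))"
    by (rule collapse_forbid_one[where x = y]) (use assms xyz in \<open>auto simp: avoiding_def\<close>)
  also have "insert {a, b} (B \<union> {{a, x}, {x, y}, {y, z}, {z, b}}) = insert {a, x} ?F2"
    by blast
  finally have 1: "collapse_equiv (avoiding V (B \<union> {{a, x}, {x, y}, {y, z}, {z, b}}))
      (avoiding V (insert {a, x} ?F2))"
    by (rule collapse_equivI)
  \<comment> \<open>Read backwards, this allows \<open>{a, x}\<close> again: \<open>x\<close>
    excludes \<open>y\<close> and \<open>a\<close> excludes \<open>b\<close>, the two neighbours of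
    \<open>z\<close>. If \<open>a = b\<close>, no simplex contains \<open>a\<close>.\<close>
  have 2: "collapse_equiv (avoiding V ?F2) (avoiding V (insert {a, x} ?F2))"
    by (intro collapse_equivI, rule collapse_forbid_one[where x = z])
      (use assms xyz in \<open>auto simp: avoiding_def\<close>)
  \<comment> \<open>The only forbidden set through \<open>x\<close> is now \<open>{x, y}\<close>,
    and \<open>z\<close> excludes \<open>y\<close>.\<close>
  have 3: "collapse_equiv (avoiding V ?F2) (avoiding V (insert {z} ?F2))"
    by (intro collapse_equivI, rule collapse_forbid_one[where x = x])
      (use assms xyz in \<open>auto simp: avoiding_def\<close>)
  have "avoiding V (insert {z} ?F2) = avoiding (V - {z}) (B \<union> {{a, b}, {x, y}})"
    by (auto simp: avoiding_def)
  then show ?thesis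
    using equivclp_trans[OF 1 equivclp_trans[OF equivclp_sym[OF 2] 3]] by simp
qed

text \<open>For \<open>n = 1\<close> the closing edge is \<open>{1}\<close>, so the loop deletes its
  vertex; for \<open>n = 2\<close> it coincides with \<open>{1, 2}\<close>, as parallel edges impose
  the same condition.\<close>

definition cycle_edges :: "nat \<Rightarrow> nat set set" where
  "cycle_edges n = insert {n, 1} ((\<lambda>j. {j, Suc j}) ` {1..<n})"

definition pairs :: "nat set \<Rightarrow> nat set set" where
  "pairs A = (\<lambda>a. {a, Suc a}) ` A"

definition cycle_and_pairs :: "nat \<Rightarrow> nat set \<Rightarrow> nat set set" where
  "cycle_and_pairs n A = avoiding ({1..n} \<union> \<Union>(pairs A)) (cycle_edges n \<union> pairs A)"

text \<open>The path used is \<open>n\<close>, \<open>n + 1\<close>, \<open>n + 2\<close>,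
  \<open>n + 3\<close>, \<open>1\<close>; its vertex \<open>n + 3\<close> disappears and
  \<open>{n + 1, n + 2}\<close> splits off. For \<open>n = 1\<close> the two ends of the path
  agree.\<close>

lemma cycle_and_pairs_step:
  assumes "n \<ge> 1" "finite A" "\<And>a. a \<in> A \<Longrightarrow> n + 3 < a"
  shows "collapse_equiv (cycle_and_pairs (n + 3) A) (cycle_and_pairs n (insert (n + 1) A))"
proof -
  let ?V = "{1..n + 3} \<union> \<Union>(pairs A)"
  let ?B = "(\<lambda>j. {j, Suc j}) ` {1..<n} \<union> pairs A"
  have "{1..<n + 3} = {1..<n} \<union> {n, n + 1, n + 2}" using assms(1) by auto
  then have E: "cycle_edges (n + 3) \<union> pairs A
      = ?B \<union> {{n, n + 1}, {n + 1, n + 2}, {n + 2, n + 3}, {n + 3, 1}}"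
    unfolding cycle_edges_def by (simp add: image_Un insert_commute Un_ac numeral_3_eq_3)
  have "collapse_equiv (avoiding ?V (?B \<union> {{n, n + 1}, {n + 1, n + 2}, {n + 2, n + 3}, {n + 3, 1}}))
      (avoiding (?V - {n + 3}) (?B \<union> {{n, 1}, {n + 1, n + 2}}))"
    using assms by (intro collapse_equiv_path) (force simp: pairs_def)+
  moreover have "?V - {n + 3} = {1..n} \<union> \<Union>(pairs (insert (n + 1) A))"
    using assms(3) by (force simp: pairs_def)
  moreover have "?B \<union> {{n, 1}, {n + 1, n + 2}} = cycle_edges n \<union> pairs (insert (n + 1) A)"
    by (auto simp: cycle_edges_def pairs_def)
  ultimately show ?thesis by (simp add: cycle_and_pairs_def E)
qed

text \<open>These are the lower ends of the edges split off when a cycle on \<open>n + 3 * m\<close>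
  vertices is shortened to \<open>n\<close> vertices.\<close>

definition spaced :: "nat \<Rightarrow> nat \<Rightarrow> nat set" where
  "spaced n m = (\<lambda>t. n + 3 * t + 1) ` {..<m}"

lemma finite_spaced [simp]: "finite (spaced n m)"
  by (simp add: spaced_def)

lemma card_spaced [simp]: "card (spaced n m) = m"
proof -
  have "inj_on (\<lambda>t. n + 3 * t + 1) {..<m}" by (rule inj_onI) simp
  then show ?thesis by (simp add: spaced_def card_image)
qed

lemma spaced_bounds:
  assumes "a \<in> spaced n m"
  shows "n < a" "a + 2 \<le> n + 3 * m"
  using assms by (auto simp: spaced_def)

text \<open>All elements are congruent modulo 3. Hence the edges in
  \<open>pairs (spaced n m)\<close> are disjoint.\<close>

lemma Suc_notin_spaced:
  assumes "a \<in> spaced n m"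
  shows "Suc a \<notin> spaced n m"
proof
  assume "Suc a \<in> spaced n m"
  then obtain t' where "Suc a = n + 3 * t' + 1" unfolding spaced_def by blast
  moreover obtain t where "a = n + 3 * t + 1" using assms unfolding spaced_def by blast
  ultimately show False by presburger
qed

lemma Suc_notin_insert_spaced:
  assumes "n \<ge> 2" "a \<in> insert 1 (spaced n m)"
  shows "Suc a \<notin> insert 1 (spaced n m)"
  using assms Suc_notin_spaced[of a n m] spaced_bounds(1)[of "Suc 1" n m] by (auto dest: spaced_bounds(1))

lemma cycle_and_pairs_reduce:
  assumes "n \<ge> 1"
  shows "collapse_equiv (cycle_and_pairs (n + 3 * m) {})
           (cycle_and_pairs n (spaced n m))"
  using assms unfolding spaced_def
proof (induction m arbitrary: n)
  case (Suc m)
  \<comment> \<open>The cycle is first shortened to \<open>n + 3\<close> vertices, so that the last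
    edge split off, at \<open>n + 1\<close>, lies below all earlier ones.\<close>
  have "collapse_equiv (cycle_and_pairs (n + 3 + 3 * m) {})
      (cycle_and_pairs (n + 3) ((\<lambda>t. n + 3 + 3 * t + 1) ` {..<m}))"
    by (rule Suc.IH) simp
  also have "collapse_equiv \<dots>
      (cycle_and_pairs n (insert (n + 1) ((\<lambda>t. n + 3 + 3 * t + 1) ` {..<m})))"
    using Suc.prems by (intro cycle_and_pairs_step) auto
  also have "insert (n + 1) ((\<lambda>t. n + 3 + 3 * t + 1) ` {..<m})
      = (\<lambda>t. n + 3 * t + 1) ` {..<Suc m}"
    by (simp add: lessThan_Suc_eq_insert_0 image_image add_ac)
  finally show ?case by (simp add: add_ac)
qed simp

section \<open>Three points joined to a complex\<close>

text \<open>The intermediate complex consists of the join of \<open>{p, r}\<close> with a prism over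
  \<open>avoiding S F\<close>, together with the join of \<open>q\<close> with the bottom of the prism; \<open>g\<close> maps
  the bottom of the prism to its top.  The join with three points arises by collapsing the prism to
  its bottom, the wedge by collapsing it to its top in the join with \<open>r\<close> and to the union of both
  ends in the join with \<open>p\<close>.\<close>

lemma collapse_equiv_three_points:
  fixes S :: "'a set"
  assumes "finite S" "\<Union>F \<subseteq> S" "{} \<notin> F" and g: "inj_on g S" "g ` S \<inter> S = {}"
    and "distinct [p, q, r]" "{p, q, r} \<inter> (S \<union> g ` S) = {}"
  shows "collapse_equiv (avoiding ({p, q, r} \<union> S) (F \<union> {{p, q}, {q, r}, {p, r}}))
           (avoiding ({p, q} \<union> S) (insert {p, q} F) \<union>
            avoiding ({p, r} \<union> g ` S) (insert {p, r} ((`) g ` F)))"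
proof -
  \<comment> \<open>The projection of the prism onto its bottom \<open>S\<close>; \<open>u\<close>
    and \<open>g u\<close> become twins.\<close>
  define \<pi> where "\<pi> u = (if u \<in> S then u else inv_into S g u)" for u
  have \<pi>S: "\<pi> u = u" "\<pi> (g u) = u" if "u \<in> S" for u
    using that g by (auto simp: \<pi>_def)
  \<comment> \<open>Avoiding \<open>P\<close> means that the projection of a simplex avoids
    \<open>F\<close>. Twins may occur together, so this prism has more simplices than the usual
    triangulation.\<close>
  define P where "P = {e. e \<subseteq> S \<union> g ` S \<and> \<pi> ` e \<in> F}"
  define T where "T = {{p, q}, {q, r}, {p, r}}"
  define V where "V = {p, q, r} \<union> S \<union> g ` S"
  define M where "M = P \<union> T \<union> (\<lambda>u. {q, g u}) ` S"
  \<comment> \<open>Forbidding \<open>D1\<close> deletes the top, \<open>D2\<close> separates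
    \<open>r\<close> from the bottom, and \<open>D3\<close> separates the two ends of the
    prism.\<close>
  define D1 where "D1 = (\<lambda>u. {g u}) ` S"
  define D2 where "D2 = (\<lambda>u. {r, u}) ` S"
  define D3 where "D3 = (\<lambda>(u, u'). {u, g u'}) ` (S \<times> S)"
  have fin: "finite V" "finite D1" "finite D2" "finite D3"
    using assms(1) by (auto simp: V_def D1_def D2_def D3_def)
  have ne: "{} \<notin> M" "{} \<notin> M \<union> D2" "{} \<notin> D1" "{} \<notin> D2" "{} \<notin> D3"
    using assms(3) by (auto simp: M_def P_def T_def D1_def D2_def D3_def)
  have disj: "p \<noteq> q" "q \<noteq> r" "p \<noteq> r"
    "\<And>u. u \<in> S \<Longrightarrow> u \<noteq> p \<and> u \<noteq> q \<and> u \<noteq> r \<and> g u \<noteq> p \<and> g u \<noteq> q \<and> g u \<noteq> r"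
    "\<And>u u'. u \<in> S \<Longrightarrow> u' \<in> S \<Longrightarrow> g u \<noteq> u'"
    using assms(5-7) by auto
  \<comment> \<open>Adding the twin \<open>v\<close> of a vertex \<open>u\<close> already in
    \<open>\<sigma>\<close> is harmless for \<open>P\<close>: in an offending set \<open>v\<close>
    can be replaced by \<open>u\<close> without changing the projection.\<close>
  have double: "\<not> e \<subseteq> insert v \<sigma>"
    if "e \<in> P" "\<And>e. e \<in> P \<Longrightarrow> \<not> e \<subseteq> \<sigma>" "u \<in> \<sigma>" "u \<in> S \<union> g ` S" "\<pi> u = \<pi> v" for e u v \<sigma>
  proof
    assume "e \<subseteq> insert v \<sigma>"
    define e' where "e' = (if v \<in> e then insert u (e - {v}) else e)"
    have "\<pi> ` e' = \<pi> ` e" using that(5) by (auto simp: e'_def image_iff)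
    then have "e' \<in> P" using that(1,4) by (auto simp: P_def e'_def)
    moreover have "e' \<subseteq> \<sigma>" using \<open>e \<subseteq> insert v \<sigma>\<close> that(3) by (auto simp: e'_def)
    ultimately show False using that(2) by blast
  qed
  \<comment> \<open>The apex for \<open>{g u}\<close> is its twin \<open>u\<close>: only members of
    \<open>P\<close> among the forbidden sets contain \<open>u\<close>.\<close>
  have 1: "collapse_equiv (avoiding V M) (avoiding V (M \<union> D1))"
  proof (intro collapse_equivI collapse_forbid fin ne)
    fix s assume "s \<in> D1"
    then obtain u where u: "s = {g u}" "u \<in> S" by (auto simp: D1_def)
    have "insert u \<sigma> \<in> avoiding V M" if "\<sigma> \<in> avoiding V M" "s \<subseteq> \<sigma>" for \<sigma>
    proof -
      have \<sigma>: "\<sigma> \<subseteq> V" "\<And>e. e \<in> M \<Longrightarrow> \<not> e \<subseteq> \<sigma>" using that(1) by (auto simp: avoiding_def)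
      have "\<not> e \<subseteq> insert u \<sigma>" if "e \<in> M" for e
      proof (cases "e \<in> P")
        case True
        show ?thesis
          by (rule double[OF True, where u = "g u"])
            (use \<sigma>(2) \<open>s \<subseteq> \<sigma>\<close> u \<pi>S in \<open>auto simp: M_def\<close>)
      next
        case False
        then have "u \<notin> e" using that u(2) disj by (auto simp: M_def T_def)
        then show ?thesis using \<sigma>(2)[OF that] by blast
      qed
      then show ?thesis using \<sigma>(1) u(2) by (auto simp: avoiding_def V_def)
    qed
    moreover have "u \<notin> \<Union>D1" using u(2) disj(5) by (force simp: D1_def)
    ultimately show "\<exists>x. x \<notin> \<Union>D1 \<and>
        (\<forall>\<sigma>\<in>avoiding V M. s \<subseteq> \<sigma> \<longrightarrow> insert x \<sigma> \<in> avoiding V M)" by blast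
  qed
  \<comment> \<open>The apex for \<open>{r, u}\<close> is \<open>g u\<close>; its only obstruction
    outside \<open>P\<close> is \<open>{q, g u}\<close>, and \<open>r\<close> excludes
    \<open>q\<close>.\<close>
  have 2: "collapse_equiv (avoiding V M) (avoiding V (M \<union> D2))"
  proof (intro collapse_equivI collapse_forbid fin ne)
    fix s assume "s \<in> D2"
    then obtain u where u: "s = {r, u}" "u \<in> S" by (auto simp: D2_def)
    have "insert (g u) \<sigma> \<in> avoiding V M" if "\<sigma> \<in> avoiding V M" "s \<subseteq> \<sigma>" for \<sigma>
    proof -
      have \<sigma>: "\<sigma> \<subseteq> V" "\<And>e. e \<in> M \<Longrightarrow> \<not> e \<subseteq> \<sigma>" using that(1) by (auto simp: avoiding_def)
      have "q \<notin> \<sigma>" using \<sigma>(2)[of "{q, r}"] \<open>s \<subseteq> \<sigma>\<close> u by (auto simp: M_def T_def)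
      have "\<not> e \<subseteq> insert (g u) \<sigma>" if "e \<in> M" for e
      proof (cases "e \<in> P")
        case True
        show ?thesis
          by (rule double[OF True, where u = u])
            (use \<sigma>(2) \<open>s \<subseteq> \<sigma>\<close> u \<pi>S in \<open>auto simp: M_def\<close>)
      next
        case False
        then have "g u \<notin> e \<or> q \<in> e" using that u(2) disj by (auto simp: M_def T_def)
        moreover have "q \<noteq> g u" using disj(4)[OF u(2)] by auto
        ultimately show ?thesis using \<sigma>(2)[OF that] \<open>q \<notin> \<sigma>\<close> by blast
      qed
      then show ?thesis using \<sigma>(1) u(2) by (auto simp: avoiding_def V_def)
    qed
    moreover have "g u \<notin> \<Union>D2" using u(2) disj(4,5) by (auto simp: D2_def)
    ultimately show "\<exists>x. x \<notin> \<Union>D2 \<and>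
        (\<forall>\<sigma>\<in>avoiding V M. s \<subseteq> \<sigma> \<longrightarrow> insert x \<sigma> \<in> avoiding V M)" by blast
  qed
  \<comment> \<open>In a simplex containing \<open>{u, g u'}\<close>, the vertex \<open>g u'\<close>
    excludes \<open>q\<close> and, thanks to \<open>D2\<close>, \<open>u\<close> excludes
    \<open>r\<close>. This leaves no obstruction to the apex \<open>p\<close>.\<close>
  have 3: "collapse_equiv (avoiding V (M \<union> D2)) (avoiding V (M \<union> D2 \<union> D3))"
  proof (intro collapse_equivI collapse_forbid fin ne)
    fix s assume "s \<in> D3"
    then obtain u u' where u: "s = {u, g u'}" "u \<in> S" "u' \<in> S" by (auto simp: D3_def)
    have "insert p \<sigma> \<in> avoiding V (M \<union> D2)" if "\<sigma> \<in> avoiding V (M \<union> D2)" "s \<subseteq> \<sigma>" for \<sigma>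
    proof -
      have \<sigma>: "\<sigma> \<subseteq> V" "\<And>e. e \<in> M \<union> D2 \<Longrightarrow> \<not> e \<subseteq> \<sigma>"
        using that(1) by (auto simp: avoiding_def)
      have "{q, g u'} \<in> M \<union> D2" "{r, u} \<in> M \<union> D2" using u by (auto simp: M_def D2_def)
      then have "\<not> {q, g u'} \<subseteq> \<sigma>" "\<not> {r, u} \<subseteq> \<sigma>" using \<sigma>(2) by blast+
      then have "q \<notin> \<sigma>" "r \<notin> \<sigma>" using \<open>s \<subseteq> \<sigma>\<close> u by auto
      have "\<not> e \<subseteq> insert p \<sigma>" if "e \<in> M \<union> D2" for e
      proof -
        have "p \<notin> e \<or> q \<in> e \<or> r \<in> e"
          using that disj assms(7) by (auto simp: M_def T_def P_def D2_def)
        then show ?thesis using \<sigma>(2)[OF that] \<open>q \<notin> \<sigma>\<close> \<open>r \<notin> \<sigma>\<close> disj by auto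
      qed
      then show ?thesis using \<sigma>(1) by (auto simp: avoiding_def V_def)
    qed
    moreover have "p \<notin> \<Union>D3" using disj(4) by (force simp: D3_def)
    ultimately show "\<exists>x. x \<notin> \<Union>D3 \<and> (\<forall>\<sigma>\<in>avoiding V (M \<union> D2).
        s \<subseteq> \<sigma> \<longrightarrow> insert x \<sigma> \<in> avoiding V (M \<union> D2))" by blast
  qed
  have \<pi>id: "\<pi> ` e = e" if "e \<subseteq> S" for e
    using that \<pi>S(1) by (force simp: image_iff)
  have \<pi>g: "\<pi> ` g ` e = e" if "e \<subseteq> S" for e
    using that \<pi>S(2) by (force simp: image_iff)
  have FP: "F \<subseteq> P" and gFP: "(`) g ` F \<subseteq> P"
  proof -
    have "e \<in> P \<and> g ` e \<in> P" if "e \<in> F" for e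
    proof -
      have "e \<subseteq> S" using that assms(2) by blast
      then show ?thesis using that \<pi>id[of e] \<pi>g[of e] by (auto simp: P_def)
    qed
    then show "F \<subseteq> P" "(`) g ` F \<subseteq> P" by auto
  qed
  have PS: "e \<in> F" if "e \<in> P" "e \<subseteq> S" for e
    using that \<pi>id by (auto simp: P_def)
  have Pg: "e \<in> (`) g ` F" if e: "e \<in> P" "e \<subseteq> g ` S" for e
  proof -
    obtain d where "d \<subseteq> S" "e = g ` d" using e(2) by (auto elim: subset_imageE)
    then show ?thesis using e(1) \<pi>g[of d] by (auto simp: P_def)
  qed
  have PSg: "e \<subseteq> S \<union> g ` S" if "e \<in> P" for e using that by (auto simp: P_def)
  have A: "avoiding V (M \<union> D1) = avoiding ({p, q, r} \<union> S) (F \<union> {{p, q}, {q, r}, {p, r}})"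
  proof (intro set_eqI iffI)
    fix \<sigma> assume "\<sigma> \<in> avoiding V (M \<union> D1)"
    then have \<sigma>: "\<sigma> \<subseteq> V" "\<And>e. e \<in> M \<union> D1 \<Longrightarrow> \<not> e \<subseteq> \<sigma>" by (auto simp: avoiding_def)
    have "\<sigma> \<subseteq> {p, q, r} \<union> S" using \<sigma>(1) \<sigma>(2)[of "{g _}"] by (auto simp: V_def D1_def)
    moreover have "F \<union> {{p, q}, {q, r}, {p, r}} \<subseteq> M \<union> D1" using FP by (auto simp: M_def T_def)
    ultimately show "\<sigma> \<in> avoiding ({p, q, r} \<union> S) (F \<union> {{p, q}, {q, r}, {p, r}})"
      using \<sigma>(2) unfolding avoiding_def by blast
  next
    fix \<sigma> assume "\<sigma> \<in> avoiding ({p, q, r} \<union> S) (F \<union> {{p, q}, {q, r}, {p, r}})"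
    then have \<sigma>: "\<sigma> \<subseteq> {p, q, r} \<union> S" "\<And>e. e \<in> F \<union> T \<Longrightarrow> \<not> e \<subseteq> \<sigma>"
      by (auto simp: avoiding_def T_def)
    have g\<sigma>: "g u \<notin> \<sigma>" if "u \<in> S" for u using that \<sigma>(1) disj by auto
    have "\<not> e \<subseteq> \<sigma>" if "e \<in> M \<union> D1" for e
    proof
      assume "e \<subseteq> \<sigma>"
      then have "e \<in> P \<or> e \<in> T" using that g\<sigma> by (auto simp: M_def D1_def)
      moreover have "e \<in> F" if "e \<in> P"
        using PS[OF that] PSg[OF that] \<open>e \<subseteq> \<sigma>\<close> g\<sigma> by blast
      ultimately show False using \<sigma>(2) \<open>e \<subseteq> \<sigma>\<close> by blast
    qed
    then show "\<sigma> \<in> avoiding V (M \<union> D1)" using \<sigma>(1) by (auto simp: avoiding_def V_def)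
  qed
  have B: "avoiding V (M \<union> D2 \<union> D3) = avoiding ({p, q} \<union> S) (insert {p, q} F) \<union>
            avoiding ({p, r} \<union> g ` S) (insert {p, r} ((`) g ` F))"
  proof (intro set_eqI iffI)
    fix \<sigma> assume "\<sigma> \<in> avoiding V (M \<union> D2 \<union> D3)"
    then have \<sigma>: "\<sigma> \<subseteq> V" "\<And>e. e \<in> M \<union> D2 \<union> D3 \<Longrightarrow> \<not> e \<subseteq> \<sigma>" by (auto simp: avoiding_def)
    have qr: "\<not> {q, r} \<subseteq> \<sigma>" by (intro \<sigma>(2)) (auto simp: M_def T_def)
    have qg: "\<not> {q, g u} \<subseteq> \<sigma>" if "u \<in> S" for u
      by (intro \<sigma>(2)) (use that in \<open>auto simp: M_def\<close>)
    have ru: "\<not> {r, u} \<subseteq> \<sigma>" if "u \<in> S" for u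
      by (intro \<sigma>(2)) (use that in \<open>auto simp: D2_def\<close>)
    have ug: "\<not> {u, g u'} \<subseteq> \<sigma>" if "u \<in> S" "u' \<in> S" for u u'
      by (intro \<sigma>(2)) (use that in \<open>force simp: D3_def\<close>)
    \<comment> \<open>A vertex of \<open>S\<close> excludes \<open>r\<close> and the top, and so
      does \<open>q\<close>; without either of them only \<open>p\<close>, \<open>r\<close> and the
      top remain.\<close>
    have "\<sigma> \<subseteq> {p, q} \<union> S \<or> \<sigma> \<subseteq> {p, r} \<union> g ` S"
    proof (cases "\<sigma> \<inter> S = {}")
      case True
      show ?thesis
      proof (cases "q \<in> \<sigma>")
        case q: True
        then have "r \<notin> \<sigma>" "\<And>u. u \<in> S \<Longrightarrow> g u \<notin> \<sigma>" using qr qg by auto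
        then show ?thesis using \<sigma>(1) by (auto simp: V_def)
      next
        case False
        then show ?thesis using \<sigma>(1) True by (auto simp: V_def)
      qed
    next
      case False
      then obtain u where "u \<in> \<sigma>" "u \<in> S" by blast
      then have "r \<notin> \<sigma>" "\<And>u'. u' \<in> S \<Longrightarrow> g u' \<notin> \<sigma>" using ru ug by auto
      then show ?thesis using \<sigma>(1) by (auto simp: V_def)
    qed
    moreover have "\<not> e \<subseteq> \<sigma>" if "e \<in> insert {p, q} F \<union> insert {p, r} ((`) g ` F)" for e
    proof (rule \<sigma>(2))
      show "e \<in> M \<union> D2 \<union> D3" using that FP gFP by (auto simp: M_def T_def)
    qed
    ultimately show "\<sigma> \<in> avoiding ({p, q} \<union> S) (insert {p, q} F) \<union>
        avoiding ({p, r} \<union> g ` S) (insert {p, r} ((`) g ` F))"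
      by (elim disjE) (rule UnI1, simp add: avoiding_def del: insert_subset,
          rule UnI2, simp add: avoiding_def del: insert_subset)
  next
    fix \<sigma> assume "\<sigma> \<in> avoiding ({p, q} \<union> S) (insert {p, q} F) \<union>
        avoiding ({p, r} \<union> g ` S) (insert {p, r} ((`) g ` F))"
    then consider
      "\<sigma> \<in> avoiding ({p, q} \<union> S) (insert {p, q} F)" |
      "\<sigma> \<in> avoiding ({p, r} \<union> g ` S) (insert {p, r} ((`) g ` F))"
      by blast
    then show "\<sigma> \<in> avoiding V (M \<union> D2 \<union> D3)"
    proof cases
      case 1
      then have 1: "\<sigma> \<subseteq> {p, q} \<union> S" "\<And>e. e \<in> insert {p, q} F \<Longrightarrow> \<not> e \<subseteq> \<sigma>"
        unfolding avoiding_def by blast+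
      have "r \<notin> \<sigma>" "\<And>u. u \<in> S \<Longrightarrow> g u \<notin> \<sigma>" using 1(1) disj by auto
      note out = this
      have "\<not> e \<subseteq> \<sigma>" if "e \<in> P" for e
      proof
        assume "e \<subseteq> \<sigma>"
        then have "e \<subseteq> S" using PSg[OF that] out(2) by auto
        then show False using 1(2)[of e] PS[OF that] \<open>e \<subseteq> \<sigma>\<close> by auto
      qed
      with out have "\<not> e \<subseteq> \<sigma>" if "e \<in> M \<union> D2 \<union> D3" for e
        using that 1(2)[of "{p, q}"] by (auto simp: M_def T_def D2_def D3_def)
      then show ?thesis using 1(1) by (auto simp: avoiding_def V_def)
    next
      case 2
      then have 2: "\<sigma> \<subseteq> {p, r} \<union> g ` S"
        "\<And>e. e \<in> insert {p, r} ((`) g ` F) \<Longrightarrow> \<not> e \<subseteq> \<sigma>"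
        unfolding avoiding_def by blast+
      have "q \<notin> \<sigma>" "\<And>u. u \<in> S \<Longrightarrow> u \<notin> \<sigma>" using 2(1) disj by auto
      note out = this
      have "\<not> e \<subseteq> \<sigma>" if "e \<in> P" for e
      proof
        assume "e \<subseteq> \<sigma>"
        then have "e \<subseteq> g ` S" using PSg[OF that] out(2) by auto
        then show False using 2(2)[of e] Pg[OF that] \<open>e \<subseteq> \<sigma>\<close> by auto
      qed
      with out have "\<not> e \<subseteq> \<sigma>" if "e \<in> M \<union> D2 \<union> D3" for e
        using that 2(2)[of "{p, r}"] by (auto simp: M_def T_def D2_def D3_def)
      then show ?thesis using 2(1) by (auto simp: avoiding_def V_def)
    qed
  qed
  show ?thesis
    using equivclp_trans[OF equivclp_sym[OF 1] equivclp_trans[OF 2 3]] unfolding A B .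
qed

section \<open>Cross-polytopes and cycles\<close>

abbreviation pairs_complex :: "nat set \<Rightarrow> nat set set" where
  "pairs_complex A \<equiv> avoiding (\<Union>(pairs A)) (pairs A)"

text \<open>A simplex of the join is determined by its fibres over the indices, and a fibre is a
  proper subset of \<open>{0, 1}\<close> exactly if it does not contain both points. For
  \<open>n = -1\<close> there are no indices and both sides are \<open>{{}}\<close>.\<close>

lemma diamond_eq_avoiding:
  "diamond n = avoiding ({0..n} \<times> {0, 1}) ((\<lambda>t. {(t, 0), (t, 1)}) ` {0..n})"
proof (intro set_eqI iffI)
  fix \<sigma> assume "\<sigma> \<in> diamond n"
  then obtain s where s: "\<sigma> = Sigma {0..n} s" "\<And>t. t \<in> {0..n} \<Longrightarrow> s t \<subset> {0..1}"
    by (auto simp: diamond_def join_family_def simplex_boundary_def)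
  have 01: "{0..1} = {0, 1::nat}" by auto
  have "\<not> {(t, 0), (t, 1)} \<subseteq> \<sigma>" if "t \<in> {0..n}" for t
    using s(2)[OF that] unfolding s(1) 01 by auto
  moreover have "\<sigma> \<subseteq> {0..n} \<times> {0, 1}"
    using s(2) unfolding s(1) 01 by blast
  ultimately show "\<sigma> \<in> avoiding ({0..n} \<times> {0, 1}) ((\<lambda>t. {(t, 0), (t, 1)}) ` {0..n})"
    by (auto simp: avoiding_def)
next
  fix \<sigma> :: "(int \<times> nat) set"
  assume "\<sigma> \<in> avoiding ({0..n} \<times> {0, 1}) ((\<lambda>t. {(t, 0), (t, 1)}) ` {0..n})"
  then have \<sigma>: "\<sigma> \<subseteq> {0..n} \<times> {0, 1}" "\<And>t. t \<in> {0..n} \<Longrightarrow> \<not> {(t, 0), (t, 1)} \<subseteq> \<sigma>"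
    by (auto simp: avoiding_def)
  define s where "s t = {b. (t, b) \<in> \<sigma>}" for t
  have "\<sigma> = Sigma {0..n} s" using \<sigma>(1) by (auto simp: s_def)
  moreover have "s t \<subset> {0..1}" if "t \<in> {0..n}" for t
  proof -
    have "s t \<subseteq> {0..1}" using \<sigma>(1) by (auto simp: s_def)
    moreover have "s t \<noteq> {0..1}"
    proof
      assume "s t = {0..1}"
      then have "0 \<in> s t" "1 \<in> s t" by auto
      then show False using \<sigma>(2)[OF that] by (simp add: s_def)
    qed
    ultimately show ?thesis by blast
  qed
  ultimately show "\<sigma> \<in> diamond n"
    unfolding diamond_def join_family_def simplex_boundary_def mem_Collect_eq
    by (intro exI[of _ s]) simp
qed

lemma finite_complex_diamond: "finite_complex (diamond n)"
  unfolding diamond_eq_avoiding by (intro finite_complex_avoiding) auto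

text \<open>The parameter \<open>b0\<close> selects which of the two points over \<open>t\<close>
  goes to \<open>h t\<close>, so that a given vertex can be sent to a lower end. The gaps in
  \<open>A\<close> keep the edges disjoint and \<open>f\<close> injective.\<close>

lemma diamond_image:
  assumes h: "bij_betw h {0..n} A" and A: "\<forall>a\<in>A. Suc a \<notin> A" and "b0 \<in> {0, 1}"
  defines "f \<equiv> \<lambda>(t, b). h t + (if b = b0 then 0 else 1)"
  shows "inj_on f (vertices (diamond n))" "(`) f ` diamond n = pairs_complex A"
proof -
  have hA: "h t \<in> A" if "t \<in> {0..n}" for t using h that by (auto simp: bij_betw_def)
  have inj: "inj_on f ({0..n} \<times> {0, 1})"
  proof (rule inj_onI, clarify)
    fix t b t' b' assume t: "t \<in> {0..n}" "t' \<in> {0..n}" and b: "b \<in> {0, 1}" "b' \<in> {0, 1}"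
      and eq: "f (t, b) = f (t', b')"
    have "Suc (h t) \<noteq> h t'" "Suc (h t') \<noteq> h t" using A hA t by metis+
    then have "h t = h t'" "b = b0 \<longleftrightarrow> b' = b0" using eq by (auto simp: f_def split: if_splits)
    then show "t = t' \<and> b = b'"
      using h t b assms(3) by (auto simp: bij_betw_def dest: inj_onD)
  qed
  then show "inj_on f (vertices (diamond n))" by (simp add: vertices_diamond)
  have f: "f ` {(t, 0), (t, 1)} = {h t, Suc (h t)}" for t
    using assms(3) by (auto simp: f_def)
  have "A = h ` {0..n}" using h by (simp add: bij_betw_def)
  then have F: "(`) f ` (\<lambda>t. {(t, 0), (t, 1)}) ` {0..n} = pairs A"
    unfolding image_image f by (simp add: pairs_def image_image)
  have V: "{0..n} \<times> {0, 1} = \<Union>((\<lambda>t. {(t, 0), (t, 1::nat)}) ` {0..n})" by auto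
  have "f ` ({0..n} \<times> {0, 1}) = \<Union>(pairs A)"
    unfolding V image_Union F ..
  then show "(`) f ` diamond n = pairs_complex A"
    unfolding diamond_eq_avoiding using avoiding_image[OF inj equalityD2[OF V]] F by simp
qed

lemma diamond_iso_pairs_complex:
  assumes "finite A" "\<forall>a\<in>A. Suc a \<notin> A" "int (card A) = n + 1"
  shows "simplicial_iso (diamond n) (pairs_complex A)"
proof -
  have "card {0..n} = card A" using assms(3) by simp
  from finite_same_card_bij[OF finite_atLeastAtMost_int assms(1) this]
  obtain h where h: "bij_betw h {0..n} A" ..
  note d = diamond_image[OF h assms(2) insertI1]
  show ?thesis using simplicial_iso_image[OF d(1)] unfolding d(2) .
qed

text \<open>Serves wedges at arbitrary vertices: a bijection between the complements of
  \<open>t\<close> and \<open>a\<close> is extended by sending \<open>t\<close> to \<open>a\<close>,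
  and \<open>b0\<close> is taken to be the second coordinate of \<open>v\<close>.\<close>

lemma diamond_pairs_complex_at_vertex:
  assumes "finite A" "\<forall>a\<in>A. Suc a \<notin> A" "int (card A) = n + 1"
    and "v \<in> vertices (diamond n)" "a \<in> A"
  obtains f where "inj_on f (vertices (diamond n))" "f v = a"
    "(`) f ` diamond n = pairs_complex A"
proof -
  obtain t b where v: "v = (t, b)" "t \<in> {0..n}" "b \<in> {0, 1}"
    using assms(4) by (auto simp: vertices_diamond)
  have "card ({0..n} - {t}) = card (A - {a})" using assms v(2) by simp
  then obtain h where "bij_betw h ({0..n} - {t}) (A - {a})"
    using finite_same_card_bij[of "{0..n} - {t}" "A - {a}"] assms(1) by auto
  moreover have "bij_betw (h(t := a)) ({0..n} - {t}) (A - {a}) \<longleftrightarrow>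
      bij_betw h ({0..n} - {t}) (A - {a})"
    by (rule bij_betw_cong) simp
  ultimately have "bij_betw (h(t := a)) (({0..n} - {t}) \<union> {t}) ((A - {a}) \<union> {a})"
    by (intro bij_betw_combine) (auto simp: bij_betw_def)
  then have "bij_betw (h(t := a)) {0..n} A" using v(2) assms(5) by (simp add: insert_absorb)
  note d = diamond_image[OF this assms(2) v(3)]
  show thesis by (rule that[OF d(1) _ d(2)]) (subst v(1), simp)
qed

section \<open>Independence complexes of cycles\<close>

lemma independence_complex_eq_avoiding:
  assumes "\<And>e. e \<in> edges G \<Longrightarrow> \<exists>v w. ends G e = {v, w}"
  shows "independence_complex G = avoiding (verts G) (ends G ` edges G)"
proof (intro set_eqI iffI)
  fix \<sigma> assume "\<sigma> \<in> independence_complex G"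
  then have \<sigma>: "\<sigma> \<subseteq> verts G" "\<And>v w e. v \<in> \<sigma> \<Longrightarrow> w \<in> \<sigma> \<Longrightarrow> e \<in> edges G \<Longrightarrow> ends G e \<noteq> {v, w}"
    by (auto simp: independence_complex_def independent_set_def)
  have "\<not> ends G e \<subseteq> \<sigma>" if "e \<in> edges G" for e
  proof -
    \<comment> \<open>Independence is tested on pairs of vertices only, so the end sets must have
      this form; \<open>v = w\<close> is a loop.\<close>
    obtain v w where "ends G e = {v, w}" using assms \<open>e \<in> edges G\<close> by blast
    then show ?thesis using \<sigma>(2)[of v w e] that by auto
  qed
  then show "\<sigma> \<in> avoiding (verts G) (ends G ` edges G)"
    using \<sigma>(1) by (auto simp: avoiding_def)
next
  fix \<sigma> assume "\<sigma> \<in> avoiding (verts G) (ends G ` edges G)"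
  then show "\<sigma> \<in> independence_complex G"
    by (auto simp: independence_complex_def independent_set_def avoiding_def)
qed

lemma cyl_grid_one:
  assumes "n \<ge> 1"
  shows "verts (cyl_grid 1 n) = {1} \<times> {1..n}"
    and "ends (cyl_grid 1 n) ` edges (cyl_grid 1 n) =
           (\<lambda>j. {(1, j), (1, if j = n then 1 else Suc j)}) ` {1..n}"
proof -
  have "wrap_vertex n p = p" if "p \<in> {1} \<times> {1..n}" for p
    using that by (auto simp: wrap_vertex_def)
  then have "wrap_vertex n ` ({1} \<times> {1..n}) = {1} \<times> {1..n}"
    by (rule trans[OF image_cong[OF refl] image_ident])
  moreover have "{1..1} \<times> {1..n + 1} = insert (1::nat, n + 1) ({1} \<times> {1..n})"
    using assms by auto
  moreover have "wrap_vertex n (1, n + 1) = (1, 1)" by (simp add: wrap_vertex_def)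
  ultimately have "wrap_vertex n ` ({1..1} \<times> {1..n + 1}) = {1} \<times> {1..n}"
    using assms by (simp add: insert_absorb)
  then show "verts (cyl_grid 1 n) = {1} \<times> {1..n}"
    by (simp add: cyl_grid_def planar_grid_def)
  let ?E = "\<lambda>j. {(1::nat, j), (1, Suc j)}"
  have P: "edges (planar_grid 1 (n + 1)) = ?E ` {1..n}"
  proof (intro set_eqI iffI)
    fix e assume "e \<in> edges (planar_grid 1 (n + 1))"
    then obtain p q where e: "e = {p, q}" "p \<in> {1..1} \<times> {1..n + 1}" "q \<in> {1..1} \<times> {1..n + 1}"
      "grid_adj p q"
      unfolding planar_grid_def by auto
    obtain j j' where j: "p = (1, j)" "q = (1, j')" "j \<in> {1..n + 1}" "j' \<in> {1..n + 1}"
      using e(2,3) by (cases p, cases q) auto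
    have "j' = Suc j \<or> j = Suc j'" using e(4) j(1,2) by (auto simp: grid_adj_def)
    then show "e \<in> ?E ` {1..n}"
    proof
      assume "j' = Suc j"
      then show ?thesis using e(1) j by (intro image_eqI[of _ _ j]) auto
    next
      assume "j = Suc j'"
      then show ?thesis using e(1) j by (intro image_eqI[of _ _ j']) auto
    qed
  next
    fix e assume "e \<in> ?E ` {1..n}"
    then obtain j where j: "j \<in> {1..n}" "e = ?E j" by blast
    have "\<exists>p q. e = {p, q} \<and> p \<in> {1..1} \<times> {1..n + 1} \<and> q \<in> {1..1} \<times> {1..n + 1} \<and> grid_adj p q"
      by (rule exI[of _ "(1, j)"], rule exI[of _ "(1, Suc j)"]) (use j in \<open>simp add: grid_adj_def\<close>)
    then show "e \<in> edges (planar_grid 1 (n + 1))" by (simp add: planar_grid_def)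
  qed
  \<comment> \<open>Each edge has an end in column \<open>j\<close>, which is at most
    \<open>n\<close>, so it represents itself; wrapping affects only the ends of
    \<open>?E n\<close>, which closes the cycle.\<close>
  have "wrap_edge n (?E j) = ?E j" if "j \<in> {1..n}" for j
    using that by (simp add: wrap_edge_def)
  then have "wrap_edge n ` ?E ` {1..n} = ?E ` {1..n}"
    unfolding image_image by (rule image_cong[OF refl])
  then have E: "edges (cyl_grid 1 n) = ?E ` {1..n}"
    unfolding P[symmetric] by (simp add: cyl_grid_def)
  have "wrap_vertex n ` ?E j = {(1, j), (1, if j = n then 1 else Suc j)}"
    if "j \<in> {1..n}" for j
    using that by (simp add: wrap_vertex_def)
  then have "(\<lambda>j. wrap_vertex n ` ?E j) ` {1..n} =
      (\<lambda>j. {(1, j), (1, if j = n then 1 else Suc j)}) ` {1..n}"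
    by (rule image_cong[OF refl])
  moreover have "ends (cyl_grid 1 n) = (`) (wrap_vertex n)" by (auto simp: cyl_grid_def)
  ultimately show "ends (cyl_grid 1 n) ` edges (cyl_grid 1 n) =
           (\<lambda>j. {(1, j), (1, if j = n then 1 else Suc j)}) ` {1..n}"
    unfolding E image_image by simp
qed

lemma independence_complex_cyl_grid_one:
  assumes "n \<ge> 1"
  shows "finite_complex (independence_complex (cyl_grid 1 n))"
    and "simplicial_iso (independence_complex (cyl_grid 1 n)) (cycle_and_pairs n {})"
proof -
  let ?V = "{1::nat} \<times> {1..n}"
  let ?F = "(\<lambda>j. {(1::nat, j), (1, if j = n then 1 else Suc j)}) ` {1..n}"
  have "\<exists>v w. ends (cyl_grid 1 n) e = {v, w}" if "e \<in> edges (cyl_grid 1 n)" for e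
  proof -
    have "ends (cyl_grid 1 n) e \<in> ?F" using that unfolding cyl_grid_one(2)[OF assms, symmetric] by blast
    then show ?thesis by blast
  qed
  then have I: "independence_complex (cyl_grid 1 n) = avoiding ?V ?F"
    using independence_complex_eq_avoiding[of "cyl_grid 1 n"] cyl_grid_one[OF assms] by simp
  show "finite_complex (independence_complex (cyl_grid 1 n))"
    unfolding I by (intro finite_complex_avoiding) auto
  have inj: "inj_on snd ?V" by (auto simp: inj_on_def)
  have "{1..n} = insert n {1..<n}" using assms by auto
  moreover have "(\<lambda>j. {j, if j = n then 1 else Suc j}) ` {1..<n} = (\<lambda>j. {j, Suc j}) ` {1..<n}"
    by (intro image_cong) auto
  ultimately have "(`) snd ` ?F = cycle_edges n"
    by (simp add: cycle_edges_def image_image)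
  moreover have "snd ` ?V = {1..n}" by auto
  moreover have "\<Union>?F \<subseteq> ?V" by (auto split: if_splits)
  ultimately have img: "(`) snd ` avoiding ?V ?F = cycle_and_pairs n {}"
    using avoiding_image[OF inj] by (simp add: cycle_and_pairs_def pairs_def)
  have "inj_on snd (vertices (avoiding ?V ?F))"
    using inj vertices_avoiding by (rule inj_on_subset)
  then show "simplicial_iso (independence_complex (cyl_grid 1 n)) (cycle_and_pairs n {})"
    unfolding I img[symmetric] by (rule simplicial_iso_image)
qed

section \<open>The three residue classes modulo 3\<close>

lemma same_simple_homotopy_typeI:
  fixes K' L' :: "nat set set"
  assumes "finite_complex K" "finite_complex L" "simplicial_iso K K'" "simplicial_iso L L'"
    and "collapse_equiv K' L'"
  shows "same_simple_homotopy_type K L"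
proof -
  have "equivclp (\<lambda>A B. simplicial_iso A B \<or> elementary_collapse A B) K' L'"
    using assms(5) by (induction rule: equivclp_induct) (auto intro: equivclp_into_equivclp)
  then show ?thesis
    unfolding same_simple_homotopy_type_def using assms(1-4) by (intro conjI exI)
qed

text \<open>The loop forbids \<open>{1}\<close>, and the bound on \<open>A\<close> ensures that no
  pair uses this vertex.\<close>

lemma cycle_and_pairs_1:
  assumes "\<And>a. a \<in> A \<Longrightarrow> 1 < a"
  shows "cycle_and_pairs 1 A = pairs_complex A"
proof -
  have "1 \<notin> \<Union>(pairs A)" using assms by (force simp: pairs_def)
  then have "\<sigma> \<subseteq> {1..1} \<union> \<Union>(pairs A) \<and> \<not> {1} \<subseteq> \<sigma> \<longleftrightarrow> \<sigma> \<subseteq> \<Union>(pairs A)" for \<sigma>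
    by auto
  then show ?thesis
    unfolding cycle_and_pairs_def avoiding_def cycle_edges_def by auto
qed

lemma cycle_and_pairs_2: "cycle_and_pairs 2 A = pairs_complex (insert 1 A)"
proof -
  have "{1..<2} = {1::nat}" "{1..2} = {1, 2::nat}" by auto
  then show ?thesis
    by (simp add: cycle_and_pairs_def cycle_edges_def pairs_def insert_commute numeral_2_eq_2)
qed

lemma cycle_and_pairs_3:
  "cycle_and_pairs 3 A =
    avoiding ({1, 2, 3} \<union> \<Union>(pairs A)) (pairs A \<union> {{1, 2}, {2, 3}, {1, 3}})"
proof -
  have "{1..<3} = {1, 2::nat}" "{1..3} = {1, 2, 3::nat}" by auto
  then show ?thesis
    by (simp add: cycle_and_pairs_def cycle_edges_def insert_commute numeral_3_eq_3 numeral_2_eq_2)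
qed

text \<open>Shortening ends in a triangle and \<open>m\<close> edges. The triangle gives three
  points, whose join with the complex of the edges becomes two cross-polytope boundaries sharing the
  vertex \<open>1\<close>.\<close>

lemma same_type_cycle_3k:
  assumes "v \<in> vertices (diamond (int m))" "w \<in> vertices (diamond (int m))"
  shows "same_simple_homotopy_type (independence_complex (cyl_grid 1 (3 + 3 * m)))
           (wedge (diamond (int m)) v (diamond (int m)) w)"
proof -
  define A where "A = spaced 3 m"
  define S where "S = \<Union>(pairs A)"
  \<comment> \<open>As \<open>S\<close> lies in an interval of length \<open>3 * m\<close> starting
    at \<open>4\<close>, this shift moves it off itself and away from \<open>1\<close>,
    \<open>2\<close>, \<open>3\<close>.\<close>
  define g where "g = (\<lambda>u. 3 * m + u)"
  \<comment> \<open>Carries the first cross-polytope, on \<open>1\<close>, \<open>2\<close> and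
    \<open>S\<close>, to the second, on \<open>1\<close>, \<open>3\<close> and the shifted copy,
    fixing the base point \<open>1\<close>.\<close>
  define \<rho> where "\<rho> u = (if u = 1 then 1 else if u = 2 then 3 else g u)" for u
  let ?D = "diamond (int m)"
  let ?B = "pairs_complex (insert 1 A)"
  have A: "finite A" "card A = m" "1 \<notin> A"
    by (auto simp: A_def dest: spaced_bounds(1))
  have gap: "\<forall>a\<in>insert 1 A. Suc a \<notin> insert 1 A"
    using Suc_notin_insert_spaced[of 3 _ m] by (simp add: A_def)
  have "4 \<le> a \<and> a + 2 \<le> 3 * m + 3" if "a \<in> A" for a
    using spaced_bounds[of a 3 m] that by (simp add: A_def)
  then have S: "finite S" "S \<subseteq> {4..<3 * m + 4}"
    using A(1) by (fastforce simp: S_def pairs_def)+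
  have card: "int (card (insert 1 A)) = int m + 1" using A by simp
  obtain f1 where f1: "inj_on f1 (vertices ?D)" "f1 v = 1" "(`) f1 ` ?D = ?B"
    using diamond_pairs_complex_at_vertex[OF _ gap card assms(1), of 1] A(1) by auto
  obtain f2 where f2: "inj_on f2 (vertices ?D)" "f2 w = 1" "(`) f2 ` ?D = ?B"
    using diamond_pairs_complex_at_vertex[OF _ gap card assms(2), of 1] A(1) by auto
  have B: "?B = avoiding ({1, 2} \<union> S) (insert {1, 2} (pairs A))"
    by (simp add: pairs_def S_def numeral_2_eq_2)
  have img: "f ` vertices ?D \<subseteq> {1, 2} \<union> S" if "(`) f ` ?D = ?B" for f
  proof -
    have "f ` vertices ?D = vertices ((`) f ` ?D)" by (auto simp: vertices_def)
    then show ?thesis unfolding that B using vertices_avoiding by metis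
  qed
  have \<rho>S: "\<rho> u = g u" if "u \<in> S" for u using that S(2) by (auto simp: \<rho>_def)
  have inj\<rho>: "inj_on \<rho> ({1, 2} \<union> S)"
    using S(2) by (auto simp: inj_on_def \<rho>_def g_def)
  have \<rho>e: "\<rho> ` e = g ` e" if "e \<in> pairs A" for e
    using that \<rho>S unfolding S_def by (intro image_cong) auto
  have \<rho>img: "\<rho> ` S = g ` S" "(`) \<rho> ` pairs A = (`) g ` pairs A"
    by (intro image_cong refl \<rho>S \<rho>e; assumption)+
  have \<rho>12: "\<rho> 1 = 1" "\<rho> 2 = 3" by (simp_all add: \<rho>_def)
  have "(`) \<rho> ` ?B = avoiding (\<rho> ` ({1, 2} \<union> S)) ((`) \<rho> ` insert {1, 2} (pairs A))"
    unfolding B by (rule avoiding_image[OF inj\<rho>]) (auto simp: S_def)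
  also have "\<rho> ` ({1, 2} \<union> S) = {1, 3} \<union> g ` S"
    unfolding image_Un \<rho>img(1) using \<rho>12 by simp
  also have "(`) \<rho> ` insert {1, 2} (pairs A) = insert {1, 3} ((`) g ` pairs A)"
    unfolding image_insert \<rho>img(2) using \<rho>12 by simp
  finally have \<rho>B: "(`) \<rho> ` ?B = avoiding ({1, 3} \<union> g ` S) (insert {1, 3} ((`) g ` pairs A))" .
  have g: "4 \<le> g u" "g u \<notin> S" if "u \<in> S" for u
    using subsetD[OF S(2) that] S(2) by (auto simp: g_def)
  have fw: "f1 v = (\<rho> \<circ> f2) w" using f1(2) f2(2) \<rho>12(1) by simp
  have inj2: "inj_on (\<rho> \<circ> f2) (vertices ?D)"
    using f2(1) inj_on_subset[OF inj\<rho> img[OF f2(3)]] by (rule comp_inj_on)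
  \<comment> \<open>Away from \<open>w\<close> the second map takes values only in \<open>3\<close>
    and the shifted copy of \<open>S\<close>, which the first map never reaches.\<close>
  have "f1 x \<noteq> (\<rho> \<circ> f2) y" if "x \<in> vertices ?D" "y \<in> vertices ?D" "y \<noteq> w" for x y
  proof -
    have "f2 y \<noteq> 1" using inj_onD[OF f2(1), of y w] f2(2) that assms(2) by auto
    moreover have "f2 y \<in> {1, 2} \<union> S" "f1 x \<in> {1, 2} \<union> S"
      using img[OF f1(3)] img[OF f2(3)] that by auto
    ultimately have "(\<rho> \<circ> f2) y \<in> {3} \<union> g ` S" "f1 x \<in> {1, 2} \<union> S"
      using \<rho>12 \<rho>S by auto
    moreover have "3 \<notin> S" using S(2) by auto
    ultimately show ?thesis using g by fastforce
  qed
  then have "simplicial_iso (wedge ?D v ?D w) ((`) f1 ` ?D \<union> (`) (\<rho> \<circ> f2) ` ?D)"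
    by (rule simplicial_iso_wedge[OF f1(1) inj2 assms(1) fw])
  moreover have "(`) (\<rho> \<circ> f2) ` ?D = (`) \<rho> ` (`) f2 ` ?D"
    by (simp only: image_image comp_def)
  ultimately have iso: "simplicial_iso (wedge ?D v ?D w) (?B \<union> (`) \<rho> ` ?B)"
    unfolding f1(3) f2(3) by simp
  have "collapse_equiv (cycle_and_pairs (3 + 3 * m) {}) (cycle_and_pairs 3 A)"
    unfolding A_def by (rule cycle_and_pairs_reduce) simp
  \<comment> \<open>Here \<open>p = 1\<close>, \<open>q = 2\<close> and \<open>r = 3\<close>, so the
    two parts of the resulting union share \<open>1\<close>.\<close>
  also have "collapse_equiv \<dots> (?B \<union> (`) \<rho> ` ?B)"
    unfolding cycle_and_pairs_3 \<rho>B unfolding B S_def[symmetric]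
  proof (rule collapse_equiv_three_points[OF S(1)])
    show "\<Union>(pairs A) \<subseteq> S" by (simp add: S_def)
    show "{} \<notin> pairs A" by (auto simp: pairs_def)
    show "inj_on g S" by (simp add: g_def)
    show "g ` S \<inter> S = {}" using g(2) by blast
    show "distinct [1, 2, 3 :: nat]" by simp
    show "{1, 2, 3} \<inter> (S \<union> g ` S) = {}" using S(2) g(1) by fastforce
  qed
  finally have "collapse_equiv (cycle_and_pairs (3 + 3 * m) {}) (?B \<union> (`) \<rho> ` ?B)" .
  then show ?thesis
    using independence_complex_cyl_grid_one[of "3 + 3 * m"] iso
    by (intro same_simple_homotopy_typeI finite_complex_wedge finite_complex_diamond) auto
qed

text \<open>The remaining looped vertex contributes nothing, so \<open>k\<close> disjoint edges are
  left and the sphere has dimension \<open>k - 1\<close>; for \<open>k = 0\<close> only the empty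
  simplex exists.\<close>

lemma same_type_cycle_3k_plus_1:
  "same_simple_homotopy_type (independence_complex (cyl_grid 1 (1 + 3 * k))) (diamond (int k - 1))"
proof -
  define A where "A = spaced 1 k"
  have A: "finite A" "card A = k"
    by (auto simp: A_def)
  have gap: "\<forall>a\<in>A. Suc a \<notin> A"
    using Suc_notin_spaced by (simp add: A_def)
  have "collapse_equiv (cycle_and_pairs (1 + 3 * k) {}) (cycle_and_pairs 1 A)"
    unfolding A_def by (rule cycle_and_pairs_reduce) simp
  also have "cycle_and_pairs 1 A = pairs_complex A"
    by (rule cycle_and_pairs_1) (auto simp: A_def dest: spaced_bounds(1))
  finally have "collapse_equiv (cycle_and_pairs (1 + 3 * k) {}) (pairs_complex A)" .
  moreover have "simplicial_iso (diamond (int k - 1)) (pairs_complex A)"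
    using A gap by (intro diamond_iso_pairs_complex) auto
  ultimately show ?thesis
    using independence_complex_cyl_grid_one[of "1 + 3 * k"]
    by (intro same_simple_homotopy_typeI finite_complex_diamond) auto
qed

text \<open>The remaining 2-cycle counts as one more edge, \<open>{1, 2}\<close>, so there are
  \<open>k + 1\<close> disjoint edges.\<close>

lemma same_type_cycle_3k_plus_2:
  "same_simple_homotopy_type (independence_complex (cyl_grid 1 (2 + 3 * k))) (diamond (int k))"
proof -
  define A where "A = spaced 2 k"
  have A: "finite A" "card A = k" "1 \<notin> A"
    by (auto simp: A_def dest: spaced_bounds(1))
  have gap: "\<forall>a\<in>insert 1 A. Suc a \<notin> insert 1 A"
    using Suc_notin_insert_spaced[of 2 _ k] by (simp add: A_def)
  have "collapse_equiv (cycle_and_pairs (2 + 3 * k) {}) (cycle_and_pairs 2 A)"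
    unfolding A_def by (rule cycle_and_pairs_reduce) simp
  then have "collapse_equiv (cycle_and_pairs (2 + 3 * k) {}) (pairs_complex (insert 1 A))"
    by (simp only: cycle_and_pairs_2)
  moreover have "simplicial_iso (diamond (int k)) (pairs_complex (insert 1 A))"
    using A gap by (intro diamond_iso_pairs_complex) auto
  ultimately show ?thesis
    using independence_complex_cyl_grid_one[of "2 + 3 * k"]
    by (intro same_simple_homotopy_typeI finite_complex_diamond) auto
qed

theorem corollary1p4:
  fixes k i :: nat
  assumes "i \<in> {0, 1, 2}"
    and "3 * k + i \<ge> 1"
  shows "(i = 0 \<longrightarrow>
            (\<forall>v \<in> vertices (diamond (int k - 1)). \<forall>w \<in> vertices (diamond (int k - 1)).
               same_simple_homotopy_type (independence_complex (cyl_grid 1 (3 * k + i)))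
                 (wedge (diamond (int k - 1)) v (diamond (int k - 1)) w))) \<and>
         (i = 1 \<longrightarrow>
            same_simple_homotopy_type (independence_complex (cyl_grid 1 (3 * k + i)))
              (diamond (int k - 1))) \<and>
         (i = 2 \<longrightarrow>
            same_simple_homotopy_type (independence_complex (cyl_grid 1 (3 * k + i)))
              (diamond (int k)))"
proof (intro conjI impI ballI)
  fix v w
  assume "i = 0" and vw: "v \<in> vertices (diamond (int k - 1))" "w \<in> vertices (diamond (int k - 1))"
  \<comment> \<open>For \<open>i = 0\<close> the bound excludes \<open>k = 0\<close>;
    \<open>m\<close> is then the dimension of both spheres.\<close>
  then obtain m where k: "k = Suc m" using assms(2) by (cases k) auto
  then have "int k - 1 = int m" "3 * k + i = 3 + 3 * m" using \<open>i = 0\<close> by auto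
  then show "same_simple_homotopy_type (independence_complex (cyl_grid 1 (3 * k + i)))
      (wedge (diamond (int k - 1)) v (diamond (int k - 1)) w)"
    using same_type_cycle_3k vw by metis
next
  assume "i = 1"
  then show "same_simple_homotopy_type (independence_complex (cyl_grid 1 (3 * k + i)))
      (diamond (int k - 1))"
    using same_type_cycle_3k_plus_1[of k] by (simp add: add.commute)
next
  assume "i = 2"
  then show "same_simple_homotopy_type (independence_complex (cyl_grid 1 (3 * k + i)))
      (diamond (int k))"
    using same_type_cycle_3k_plus_2[of k] by (simp add: add.commute)
qed

end
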